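(* Let $$A_k(x)=\frac{x^2}{1-x^2F_{k-2}(x)}A_{k-1}(x)+\frac{x^4F_{k-1}(x)}{(1-x^2F_{k-2}(x))^2}A_{k-2}(x)$$ for all $k\geq2$, where $A_1(x)=0$ and $A_2(x)=x^4$. Then for all $k\geq2$ $$\mathcal{D}_{12\dots k;1}(x)=A_k(x)+xA_{k-1}(x).$$
   Context: A permutation $\pi$ is a Dumont permutation (of the first kind) if each even integer in $\pi$ is followed by a smaller integer, and each odd integer is either followed by a larger integer or is the last element of $\pi$. Let $\mathcal{D}_{\tau;r}(n)$ be the number of Dumont permutations of length $n$ that avoid $132$ and contain the pattern $\tau$ exactly $r$ times, and $\mathcal{D}_{\tau;r}(x)=\sum_{n\geq0}\mathcal{D}_{\tau;r}(n)x^n$. For $r\geq2$ consider $Q_r(x)=1+\frac{x^2Q_{r-1}(x)}{1-x^2Q_{r-2}(x)}$; $F_r(x)$ is its solution with $Q_0(x)=0$, $Q_1(x)=1$. *)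

theory Defs
  imports
    "HOL-Combinatorics.Multiset_Permutations"
    "HOL-Computational_Algebra.Formal_Power_Series"
begin

definition dumont :: "nat list \<Rightarrow> bool" where
  "dumont p \<longleftrightarrow> (\<forall>i<length p.
     (even (p ! i) \<longrightarrow> Suc i < length p \<and> p ! Suc i < p ! i) \<and>
     (odd (p ! i) \<longrightarrow> Suc i = length p \<or> p ! i < p ! Suc i))"

definition order_isomorphic :: "nat list \<Rightarrow> nat list \<Rightarrow> bool" where
  "order_isomorphic u v \<longleftrightarrow> length u = length v \<and>
     (\<forall>i<length u. \<forall>j<length u. u ! i < u ! j \<longleftrightarrow> v ! i < v ! j)"

definition occurrences :: "nat list \<Rightarrow> nat list \<Rightarrow> nat" where
  "occurrences t p = card {I. I \<subseteq> {..<length p} \<and> order_isomorphic (nths p I) t}"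

definition D_count :: "nat list \<Rightarrow> nat \<Rightarrow> nat \<Rightarrow> nat" where
  "D_count t r n = card {p \<in> permutations_of_set {1..n}.
     dumont p \<and> occurrences [1, 3, 2] p = 0 \<and> occurrences t p = r}"

definition D_gf :: "nat list \<Rightarrow> nat \<Rightarrow> rat fps" where
  "D_gf t r = Abs_fps (\<lambda>n. of_nat (D_count t r n))"

(* All denominators have constant term 1, so the divisions are genuine ones in the
   ring of formal power series. *)
fun F :: "nat \<Rightarrow> rat fps" where
  "F 0 = 0"
| "F (Suc 0) = 1"
| "F (Suc (Suc r)) = 1 + fps_X ^ 2 * F (Suc r) / (1 - fps_X ^ 2 * F r)"

end

theory Submission
  imports Defs "HOL-Library.Sublist"
begin

text \<open>
  In a 132-avoiding permutation everything before the maximum \<open>n\<close> exceeds everything after it.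
  Together with the parity conditions this forces a Dumont permutation of even length \<open>n > 0\<close> to be
  either \<open>n R (n-1)\<close> or \<open>L (n-1) n R\<close> with \<open>L > R\<close> and \<open>R\<close> nonempty, where \<open>L\<close> (shifted) and \<open>R\<close>
  are again such permutations of even length; one of odd length \<open>n\<close> is one of even length followed
  by \<open>n\<close>. If \<open>i\<^sub>k\<close> counts occurrences of \<open>12\<dots>k\<close>, then \<open>i\<^sub>k\<close> of the two shapes is
  \<open>i\<^sub>k(R) + i\<^sub>k\<^sub>-\<^sub>1(R)\<close> and \<open>i\<^sub>k(L) + 2 i\<^sub>k\<^sub>-\<^sub>1(L) + i\<^sub>k\<^sub>-\<^sub>2(L) + i\<^sub>k(R)\<close>. A single occurrence of
  \<open>12\<dots>(k+1)\<close> already yields \<open>k + 1\<close> occurrences of \<open>12\<dots>k\<close>, so the equations \<open>i\<^sub>k = 0\<close> and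
  \<open>i\<^sub>k = 1\<close> split into the recurrences for \<open>F\<^sub>k\<close> and \<open>A\<^sub>k\<close>.
\<close>

section \<open>Weighted generating functions\<close>

text \<open>The weight is a parameter because pairs are counted by the sum of two lengths. Infinite
  fibres would count as 0, whence the finiteness assumptions in the sum and product rules.\<close>

definition wgf :: "('a \<Rightarrow> nat) \<Rightarrow> 'a set \<Rightarrow> rat fps" where
  "wgf w S = Abs_fps (\<lambda>n. of_nat (card {a \<in> S. w a = n}))"

lemma wgf_Un:
  assumes "\<And>n. finite {a \<in> S. w a = n}" "\<And>n. finite {a \<in> T. w a = n}" "S \<inter> T = {}"
  shows "wgf w (S \<union> T) = wgf w S + wgf w T"
proof (rule fps_ext)
  fix n
  have "{a \<in> S \<union> T. w a = n} = {a \<in> S. w a = n} \<union> {a \<in> T. w a = n}" by auto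
  moreover have "{a \<in> S. w a = n} \<inter> {a \<in> T. w a = n} = {}" using assms(3) by auto
  ultimately show "fps_nth (wgf w (S \<union> T)) n = fps_nth (wgf w S + wgf w T) n"
    using assms(1)[of n] assms(2)[of n] by (simp add: wgf_def card_Un_disjoint)
qed

lemma wgf_image:
  assumes "inj_on f S" "\<And>a. a \<in> S \<Longrightarrow> w (f a) = c + v a"
  shows "wgf w (f ` S) = fps_X ^ c * wgf v S"
proof (rule fps_ext)
  fix n
  have "{b \<in> f ` S. w b = n} = f ` {a \<in> S. c + v a = n}" using assms(2) by auto
  moreover have "inj_on f {a \<in> S. c + v a = n}" using assms(1) by (auto simp: inj_on_def)
  ultimately have card: "card {b \<in> f ` S. w b = n} = card {a \<in> S. c + v a = n}"
    by (simp add: card_image)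
  show "fps_nth (wgf w (f ` S)) n = fps_nth (fps_X ^ c * wgf v S) n"
  proof (cases "n < c")
    case True
    then have "{a \<in> S. c + v a = n} = {}" by auto
    with True card show ?thesis by (simp add: wgf_def fps_X_power_mult_nth)
  next
    case False
    then have "{a \<in> S. c + v a = n} = {a \<in> S. v a = n - c}" by auto
    with False card show ?thesis by (simp add: wgf_def fps_X_power_mult_nth)
  qed
qed

lemma wgf_Times:
  assumes "\<And>n. finite {a \<in> S. w a = n}" "\<And>n. finite {a \<in> T. v a = n}"
  shows "wgf (\<lambda>(a, b). w a + v b) (S \<times> T) = wgf w S * wgf v T"
proof (rule fps_ext)
  fix n
  have "{c \<in> S \<times> T. (case c of (a, b) \<Rightarrow> w a + v b) = n}
      = (\<Union>i\<in>{0..n}. {a \<in> S. w a = i} \<times> {b \<in> T. v b = n - i})" by auto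
  moreover have "card \<dots> = (\<Sum>i\<in>{0..n}. card ({a \<in> S. w a = i} \<times> {b \<in> T. v b = n - i}))"
    by (rule card_UN_disjoint) (use assms in auto)
  ultimately show "fps_nth (wgf (\<lambda>(a, b). w a + v b) (S \<times> T)) n = fps_nth (wgf w S * wgf v T) n"
    by (simp add: wgf_def fps_mult_nth card_cartesian_product)
qed

section \<open>Counting pattern occurrences recursively\<close>

text \<open>An arbitrary predicate is allowed because removing the head of the list changes the
  predicate: the head may already have been selected.\<close>

definition sub_count :: "('a list \<Rightarrow> bool) \<Rightarrow> 'a list \<Rightarrow> nat" where
  "sub_count P p = card {I. I \<subseteq> {..<length p} \<and> P (nths p I)}"

lemma sub_count_Nil: "sub_count P [] = (if P [] then 1 else 0)"
proof -
  have "{I. I \<subseteq> {..<length ([]::'a list)} \<and> P (nths [] I)} = (if P [] then {{}} else {})" by auto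
  then show ?thesis unfolding sub_count_def by simp
qed

lemma sub_count_Cons: "sub_count P (x # p) = sub_count (\<lambda>s. P (x # s)) p + sub_count P p"
proof -
  let ?A = "{I. I \<subseteq> {..<length p} \<and> P (x # nths p I)}"
  let ?B = "{I. I \<subseteq> {..<length p} \<and> P (nths p I)}"
  let ?f = "\<lambda>I. insert 0 (Suc ` I)" and ?g = "\<lambda>I. Suc ` I"
  have pre: "{j. Suc j \<in> Suc ` I} = I" for I by auto
  have split: "{I. I \<subseteq> {..<length (x # p)} \<and> P (nths (x # p) I)} = ?f ` ?A \<union> ?g ` ?B" (is "?C = _")
  proof (intro equalityI subsetI)
    fix I assume "I \<in> ?C"
    then have I: "I \<subseteq> {..<Suc (length p)}" "P (nths (x # p) I)" by auto
    let ?J = "{j. Suc j \<in> I}"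
    have J: "?J \<subseteq> {..<length p}" using I(1) by auto
    show "I \<in> ?f ` ?A \<union> ?g ` ?B"
    proof (cases "0 \<in> I")
      case True
      have "I = ?f ?J"
      proof (rule set_eqI)
        show "i \<in> I \<longleftrightarrow> i \<in> ?f ?J" for i using True by (cases i) auto
      qed
      moreover have "?J \<in> ?A" using I(2) J True by (simp add: nths_Cons)
      ultimately show ?thesis by blast
    next
      case False
      have "I = ?g ?J"
      proof (rule set_eqI)
        show "i \<in> I \<longleftrightarrow> i \<in> ?g ?J" for i using False by (cases i) auto
      qed
      moreover have "?J \<in> ?B" using I(2) J False by (simp add: nths_Cons)
      ultimately show ?thesis by blast
    qed
  next
    fix I assume "I \<in> ?f ` ?A \<union> ?g ` ?B"
    then show "I \<in> ?C" by (auto simp: nths_Cons pre)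
  qed
  have injf: "inj_on ?f ?A"
    by (rule inj_on_inverseI[where g = "\<lambda>I. {j. Suc j \<in> I}"]) auto
  have injg: "inj_on ?g ?B"
    by (rule inj_on_inverseI[where g = "\<lambda>I. {j. Suc j \<in> I}"]) auto
  have fin: "finite ?A" "finite ?B"
    by (rule finite_subset[of _ "Pow {..<length p}"]; auto)+
  have "card (?f ` ?A \<union> ?g ` ?B) = card (?f ` ?A) + card (?g ` ?B)"
    by (rule card_Un_disjoint) (use fin in auto)
  then show ?thesis
    unfolding sub_count_def split by (simp add: card_image injf injg)
qed

lemma sub_count_False: "sub_count (\<lambda>s. False) p = 0"
  by (simp add: sub_count_def)

text \<open>The number of strictly increasing subsequences of \<open>p\<close>, by position, of
  length \<open>k\<close> with all entries above \<open>m\<close>. A selected entry becomes the new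
  lower bound.\<close>

fun incs :: "nat \<Rightarrow> nat \<Rightarrow> nat list \<Rightarrow> nat" where
  "incs m 0 p = 1"
| "incs m (Suc k) [] = 0"
| "incs m (Suc k) (x # p) = (if m < x then incs x k p else 0) + incs m (Suc k) p"

lemma incs_eq_sub_count:
  "incs m k p = sub_count (\<lambda>s. length s = k \<and> sorted_wrt (<) (m # s)) p"
proof (induction p arbitrary: m k)
  case Nil
  then show ?case by (cases k) (auto simp: sub_count_Nil)
next
  case (Cons x p)
  show ?case
  proof (cases k)
    case 0
    have "sub_count (\<lambda>s. length s = 0 \<and> sorted_wrt (<) (m # s)) p = 1"
      using Cons[of m 0] by simp
    with 0 show ?thesis by (simp add: sub_count_Cons sub_count_False)
  next
    case (Suc k')
    \<comment> \<open>Selecting \<open>x\<close> leaves the same condition with \<open>x\<close> in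
      place of \<open>m\<close>; the old bound then follows by transitivity.\<close>
    have "(\<lambda>s. length (x # s) = k \<and> sorted_wrt (<) (m # x # s))
        = (if m < x then (\<lambda>s. length s = k' \<and> sorted_wrt (<) (x # s)) else (\<lambda>s. False))"
      using Suc by (auto simp: fun_eq_iff)
    then show ?thesis
      using Suc Cons[of x k'] Cons[of m k]
      by (cases "m < x") (simp_all only: sub_count_Cons incs.simps sub_count_False if_True if_False)
  qed
qed

section \<open>The pattern 12...k as increasing subsequences\<close>

lemma order_isomorphic_upt_iff:
  "order_isomorphic s [1..<Suc k] \<longleftrightarrow> length s = k \<and> sorted_wrt (<) s"
proof -
  have "(\<forall>i<k. \<forall>j<k. s ! i < s ! j \<longleftrightarrow> i < j) \<longleftrightarrow> sorted_wrt (<) s" (is "?l \<longleftrightarrow> ?r")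
    if len: "length s = k"
  proof
    assume ?l
    then show ?r using len by (auto simp: sorted_wrt_iff_nth_less)
  next
    assume r: ?r
    have less: "s ! i < s ! j" if "i < j" "j < k" for i j
      using sorted_wrt_nth_less[OF r] that len by simp
    have "s ! i < s ! j \<longleftrightarrow> i < j" if "i < k" "j < k" for i j
      using less[of i j] less[of j i] that by (cases i j rule: linorder_cases) auto
    then show ?l by blast
  qed
  then show ?thesis by (auto simp: order_isomorphic_def simp del: upt_Suc)
qed

lemma sub_count_cong:
  assumes "\<And>s. set s \<subseteq> set p \<Longrightarrow> P s = Q s"
  shows "sub_count P p = sub_count Q p"
  unfolding sub_count_def using assms[OF set_nths_subset] by simp

text \<open>All entries are positive, so the lower bound 0 imposes nothing.\<close>

lemma occurrences_upt:
  assumes "\<forall>x\<in>set p. 0 < x"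
  shows "occurrences [1..<Suc k] p = incs 0 k p"
proof -
  have "occurrences [1..<Suc k] p = sub_count (\<lambda>s. length s = k \<and> sorted_wrt (<) s) p"
    by (simp only: occurrences_def sub_count_def order_isomorphic_upt_iff)
  also have "\<dots> = sub_count (\<lambda>s. length s = k \<and> sorted_wrt (<) (0 # s)) p"
    by (rule sub_count_cong) (use assms in auto)
  finally show ?thesis by (simp only: incs_eq_sub_count)
qed

section \<open>Increasing subsequences under shift, concatenation and shortening\<close>

lemma incs_shift: "incs (m + r) k (map (\<lambda>x. x + r) p) = incs m k p"
  by (induction m k p rule: incs.induct) auto

lemma incs_lower_bound_cong:
  assumes "\<forall>x\<in>set p. m < x \<longleftrightarrow> m' < x"
  shows "incs m k p = incs m' k p"
  using assms
proof (induction p)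
  case Nil
  then show ?case by (cases k) auto
next
  case (Cons x p)
  then show ?case by (cases k) auto
qed

text \<open>The final entry exceeds all others, so every increasing subsequence of length
  \<open>k\<close> extends by it.\<close>

lemma incs_snoc:
  assumes "\<forall>y\<in>set p. y < x" "m < x"
  shows "incs m (Suc k) (p @ [x]) = incs m (Suc k) p + incs m k p"
  using assms
proof (induction p arbitrary: m k)
  case Nil
  then show ?case by (cases k) auto
next
  case (Cons y p)
  then show ?case by (cases k) auto
qed

lemma incs_eq_0:
  assumes "\<forall>y\<in>set q. y \<le> m"
  shows "incs m (Suc k) q = 0"
  using assms by (induction q) auto

text \<open>Nothing can increase from \<open>p\<close> into \<open>q\<close>. Positive length
  matters: the empty subsequence would be counted twice.\<close>

lemma incs_append:
  assumes "\<forall>x\<in>set p. \<forall>y\<in>set q. y < x"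
  shows "incs m (Suc k) (p @ q) = incs m (Suc k) p + incs m (Suc k) q"
  using assms
proof (induction p arbitrary: m k)
  case (Cons x p)
  have "incs x (Suc j) q = 0" for j
    using Cons.prems by (intro incs_eq_0) (auto intro: less_imp_le)
  then show ?case using Cons by (cases k) auto
qed simp

lemma incs_antimono: "m \<le> m' \<Longrightarrow> incs m' k p \<le> incs m k p"
proof (induction p)
  case Nil
  then show ?case by (cases k) auto
next
  case (Cons x p)
  then show ?case by (cases k) auto
qed

text \<open>Deleting each entry in turn from one increasing subsequence of length
  \<open>k + 1\<close> gives \<open>k + 1\<close> different ones of length \<open>k\<close>.\<close>

lemma incs_Suc_pos_imp_ge: "0 < incs m (Suc k) p \<Longrightarrow> Suc k \<le> incs m k p"
proof (induction p arbitrary: m k)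
  case (Cons x p)
  show ?case
  proof (cases k)
    case (Suc j)
    show ?thesis
    proof (cases "0 < incs m (Suc k) p")
      case True
      then show ?thesis using Cons.IH[of m k] Suc by simp
    next
      \<comment> \<open>Every occurrence now starts with \<open>x\<close>: at least
        \<open>Suc j\<close> shortened ones keep \<open>x\<close>, and at least one more comes from
        deleting it.\<close>
      case False
      with Cons.prems have x: "m < x" "0 < incs x (Suc j) p"
        using Suc by (auto split: if_splits)
      then have "Suc j \<le> incs x j p" using Cons.IH by blast
      moreover have "incs x (Suc j) p \<le> incs m (Suc j) p"
        using x by (intro incs_antimono) auto
      ultimately show ?thesis using x Suc by simp
    qed
  qed simp
qed simp

section \<open>Avoiding 132 and the Dumont condition\<close>

text \<open>The head is tried as the 1; the relation on later pairs then forbids a 3 followed by a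
  2.\<close>

fun av132 :: "nat list \<Rightarrow> bool" where
  "av132 [] \<longleftrightarrow> True"
| "av132 (x # p) \<longleftrightarrow> sorted_wrt (\<lambda>b c. \<not> (x < c \<and> c < b)) p \<and> av132 p"

lemma sorted_wrt_if_all: "(\<And>x y. x \<in> set p \<Longrightarrow> y \<in> set p \<Longrightarrow> R x y) \<Longrightarrow> sorted_wrt R p"
  by (induction p) auto

lemma subseq_pair_iff_sorted_wrt:
  "(\<forall>b c. subseq [b, c] p \<longrightarrow> R b c) \<longleftrightarrow> sorted_wrt R p"
proof (induction p)
  case (Cons x p)
  have "(\<forall>b c. subseq [b, c] (x # p) \<longrightarrow> R b c) \<longleftrightarrow>
     (\<forall>c. c \<in> set p \<longrightarrow> R x c) \<and> (\<forall>b c. subseq [b, c] p \<longrightarrow> R b c)"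
    by (smt (verit) subseq_Cons2_iff subseq_Cons' subseq_singleton_left)
  with Cons show ?case by auto
qed simp

lemma av132_iff_subseq:
  "av132 p \<longleftrightarrow> (\<forall>a b c. subseq [a, b, c] p \<longrightarrow> \<not> (a < c \<and> c < b))"
proof (induction p)
  case (Cons x p)
  have "(\<forall>a b c. subseq [a, b, c] (x # p) \<longrightarrow> \<not> (a < c \<and> c < b)) \<longleftrightarrow>
     (\<forall>b c. subseq [b, c] p \<longrightarrow> \<not> (x < c \<and> c < b)) \<and>
     (\<forall>a b c. subseq [a, b, c] p \<longrightarrow> \<not> (a < c \<and> c < b))"
    by (smt (verit) subseq_Cons2_iff subseq_Cons')
  then show ?case using Cons by (simp only: av132.simps subseq_pair_iff_sorted_wrt)
qed simp

lemma order_isomorphic_132_iff: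
  "order_isomorphic s [1, 3, 2] \<longleftrightarrow> (\<exists>a b c. s = [a, b, c] \<and> a < c \<and> c < b)"
  (is "?l \<longleftrightarrow> ?r")
proof
  assume l: ?l
  then have "length s = 3" by (simp add: order_isomorphic_def)
  then obtain a b c where s: "s = [a, b, c]"
    by (auto simp: numeral_3_eq_3 length_Suc_conv)
  have *: "\<And>i j. i < 3 \<Longrightarrow> j < 3 \<Longrightarrow> s ! i < s ! j \<longleftrightarrow> [1, 3, 2::nat] ! i < [1, 3, 2] ! j"
    using l s by (auto simp: order_isomorphic_def)
  from *[of 0 2] *[of 2 1] s show ?r by simp
qed (auto simp: order_isomorphic_def less_Suc_eq)

lemma occurrences_132_eq_0_iff: "occurrences [1, 3, 2] p = 0 \<longleftrightarrow> av132 p"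
proof -
  let ?S = "{I. I \<subseteq> {..<length p} \<and> order_isomorphic (nths p I) [1, 3, 2]}"
  have "finite ?S" by (rule finite_subset[of _ "Pow {..<length p}"]) auto
  then have "occurrences [1, 3, 2] p = 0 \<longleftrightarrow> ?S = {}" by (simp add: occurrences_def)
  also have "\<dots> \<longleftrightarrow> (\<forall>I. \<not> order_isomorphic (nths p I) [1, 3, 2])"
  proof -
    have "nths p I = nths p (I \<inter> {..<length p})" for I
      unfolding nths_def by (rule arg_cong[where f = "map fst"], rule filter_cong) (auto dest!: set_zip_rightD)
    then show ?thesis by auto (metis Int_lower2)
  qed
  also have "\<dots> \<longleftrightarrow> (\<forall>s. subseq s p \<longrightarrow> \<not> order_isomorphic s [1, 3, 2])"
    by (auto simp: subseq_conv_nths)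
  also have "\<dots> \<longleftrightarrow> av132 p"
    unfolding order_isomorphic_132_iff av132_iff_subseq by blast
  finally show ?thesis .
qed

text \<open>An occurrence of 132 across the cut has either its 1 alone on the left or its 2 alone on
  the right.\<close>

lemma av132_append:
  "av132 (p @ q) \<longleftrightarrow> av132 p \<and> av132 q
     \<and> (\<forall>a\<in>set p. sorted_wrt (\<lambda>b c. \<not> (a < c \<and> c < b)) q)
     \<and> (\<forall>c\<in>set q. sorted_wrt (\<lambda>a b. \<not> (a < c \<and> c < b)) p)"
  by (induction p) (auto simp: sorted_wrt_append)

lemma av132_shift: "av132 (map (\<lambda>x. x + r) p) \<longleftrightarrow> av132 p"
  by (induction p) (auto simp: sorted_wrt_map)

section \<open>The Dumont condition as a condition on neighbours\<close>

definition dumont_step :: "nat \<Rightarrow> nat \<Rightarrow> bool" where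
  "dumont_step x y \<longleftrightarrow> (if even x then y < x else x < y)"

text \<open>Only the last entry lacks a right neighbour, and an even entry needs one; all else
  concerns adjacent entries.\<close>

lemma dumont_iff_successively:
  "dumont p \<longleftrightarrow> successively dumont_step p \<and> (p \<noteq> [] \<longrightarrow> odd (last p))"
proof (cases "p = []")
  case False
  then have last: "last p = p ! (length p - 1)" by (rule last_conv_nth)
  show ?thesis
  proof
    assume d: "dumont p"
    have "odd (last p)"
    proof (rule ccontr)
      assume "\<not> odd (last p)"
      moreover have "length p - 1 < length p" using False by simp
      ultimately have "Suc (length p - 1) < length p"
        using d last unfolding dumont_def by metis
      then show False by simp
    qed
    moreover have "dumont_step (p ! i) (p ! Suc i)" if "Suc i < length p" for i
    proof -
      have "i < length p" using that by simp
      with d have "(even (p ! i) \<longrightarrow> p ! Suc i < p ! i) \<and> (odd (p ! i) \<longrightarrow> p ! i < p ! Suc i)"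
        using that unfolding dumont_def by (metis less_irrefl)
      then show ?thesis by (simp add: dumont_step_def)
    qed
    ultimately show "successively dumont_step p \<and> (p \<noteq> [] \<longrightarrow> odd (last p))"
      by (simp add: successively_conv_nth)
  next
    assume d: "successively dumont_step p \<and> (p \<noteq> [] \<longrightarrow> odd (last p))"
    show "dumont p"
      unfolding dumont_def
    proof (intro allI impI)
      fix i assume i: "i < length p"
      show "(even (p ! i) \<longrightarrow> Suc i < length p \<and> p ! Suc i < p ! i) \<and>
            (odd (p ! i) \<longrightarrow> Suc i = length p \<or> p ! i < p ! Suc i)"
      proof (cases "Suc i = length p")
        case True
        then have "p ! i = last p" using last by (metis diff_Suc_1)
        then show ?thesis using d True False by auto
      next
        case ne: False
        then have "dumont_step (p ! i) (p ! Suc i)"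
          using d i by (simp add: successively_conv_nth)
        then show ?thesis using i ne by (auto simp: dumont_step_def split: if_splits)
      qed
    qed
  qed
qed (simp add: dumont_def)


lemma dumont_step_shift: "even r \<Longrightarrow> dumont_step (x + r) (y + r) \<longleftrightarrow> dumont_step x y"
  by (simp add: dumont_step_def)

lemma dumont_shift: "even r \<Longrightarrow> dumont (map (\<lambda>x. x + r) p) \<longleftrightarrow> dumont p"
  by (auto simp: dumont_iff_successively successively_map dumont_step_shift last_map)

text \<open>An odd entry that is not last is followed by a larger one, impossible for a maximum.
  Only the neighbour condition is assumed, so that the lemma also applies to a prefix.\<close>

lemma dumont_Max_last:
  assumes "successively dumont_step p" "m \<in> set p" "odd m" "\<forall>x\<in>set p. x \<le> m"
  obtains q where "p = q @ [m]"
proof -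
  obtain q q' where p: "p = q @ m # q'" using assms(2) by (meson split_list)
  have "q' = []"
  proof (rule ccontr)
    assume "q' \<noteq> []"
    then have "dumont_step m (hd q')" "hd q' \<in> set p"
      using assms(1) by (auto simp: p successively_append_iff successively_Cons)
    with assms(3,4) show False by (auto simp: dumont_step_def not_less)
  qed
  with p that show thesis by simp
qed

text \<open>The step from the last entry of \<open>p\<close> up to \<open>m\<close> requires that
  entry to be odd, which is exactly what \<open>dumont p\<close> demands of it.\<close>

lemma dumont_snoc_bigger:
  assumes "\<forall>x\<in>set p. x < m" "odd m"
  shows "dumont (p @ [m]) \<longleftrightarrow> dumont p"
proof (cases "p = []")
  case False
  then have "dumont_step (last p) m \<longleftrightarrow> odd (last p)"
    using assms(1)[rule_format, OF last_in_set[OF False]] by (auto simp: dumont_step_def)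
  then show ?thesis
    using assms(2) False by (auto simp: dumont_iff_successively successively_append_iff)
qed (use assms in \<open>simp add: dumont_def\<close>)

lemma av132_snoc_bigger:
  assumes "\<forall>x\<in>set p. x < m"
  shows "av132 (p @ [m]) \<longleftrightarrow> av132 p"
proof -
  have "sorted_wrt (\<lambda>a b. \<not> (a < m \<and> m < b)) p"
    using assms by (intro sorted_wrt_if_all) force
  then show ?thesis by (simp add: av132_append)
qed

section \<open>Decomposition of 132-avoiding Dumont permutations\<close>

definition dperm :: "nat list \<Rightarrow> bool" where
  "dperm p \<longleftrightarrow> distinct p \<and> set p = {1..length p} \<and> dumont p \<and> av132 p"

definition even_dperm :: "nat list \<Rightarrow> bool" where
  "even_dperm p \<longleftrightarrow> even (length p) \<and> dperm p"

definition snoc_max :: "nat list \<Rightarrow> nat list" where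
  "snoc_max p = p @ [Suc (length p)]"

definition wrap :: "nat list \<Rightarrow> nat list" where
  "wrap p = (length p + 2) # p @ [length p + 1]"

definition join :: "nat list \<Rightarrow> nat list \<Rightarrow> nat list" where
  "join p q = map (\<lambda>x. x + length q) p @ [length p + length q + 1, length p + length q + 2] @ q"

lemma dperm_Nil: "dperm []"
  by (simp add: dperm_def dumont_def)

lemma dperm_bounds: "dperm p \<Longrightarrow> x \<in> set p \<Longrightarrow> 1 \<le> x \<and> x \<le> length p"
  by (auto simp: dperm_def)

text \<open>Even length makes the appended maximum odd, so it may stand last.\<close>

lemma dperm_snoc_max_iff:
  assumes "even (length p)"
  shows "dperm (snoc_max p) \<longleftrightarrow> dperm p"
proof -
  let ?m = "Suc (length p)"
  have *: "distinct (snoc_max p) \<and> set (snoc_max p) = {1..?m} \<longleftrightarrow>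
     distinct p \<and> set p = {1..length p}"
    by (auto simp: snoc_max_def atLeastAtMostSuc_conv insert_eq_iff)
  have "dumont (snoc_max p) \<longleftrightarrow> dumont p" "av132 (snoc_max p) \<longleftrightarrow> av132 p"
    if "set p = {1..length p}"
    using that assms unfolding snoc_max_def
    by (auto intro!: dumont_snoc_bigger av132_snoc_bigger)
  then show ?thesis using * by (auto simp: dperm_def snoc_max_def)
qed

lemma odd_dperm_cases:
  assumes "dperm p" "odd (length p)"
  obtains q where "even_dperm q" "p = snoc_max q"
proof -
  obtain q where p: "p = q @ [length p]"
    by (rule dumont_Max_last[of p "length p"])
       (use assms in \<open>auto simp: dperm_def dumont_iff_successively intro: Suc_leI\<close>)
  then have len: "length p = Suc (length q)"
    by (metis length_append_singleton)
  then have q: "p = snoc_max q" using p by (simp add: snoc_max_def)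
  have "even (length q)" using assms(2) len by simp
  with q that assms show thesis by (simp add: even_dperm_def dperm_snoc_max_iff)
qed

text \<open>After the odd maximum is appended, an even entry larger than all is put in front: it
  steps down and cannot be the 1 of a 132.\<close>

lemma even_dperm_wrap:
  assumes "even_dperm p"
  shows "even_dperm (wrap p)"
proof -
  let ?m = "length p + 1"
  have d: "dperm (p @ [?m])" and e: "even (length p)"
    using assms dperm_snoc_max_iff[of p] by (auto simp: even_dperm_def snoc_max_def)
  have w: "wrap p = Suc ?m # p @ [?m]" by (simp add: wrap_def)
  have hd: "hd (p @ [?m]) < Suc ?m"
    using dperm_bounds[OF d hd_in_set] by (simp add: less_Suc_eq_le)
  have "sorted_wrt (\<lambda>b c. \<not> (Suc ?m < c \<and> c < b)) (p @ [?m])"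
    using dperm_bounds[OF d] by (intro sorted_wrt_if_all) fastforce
  then have "av132 (wrap p)" using d by (simp add: w dperm_def)
  moreover have set: "set (p @ [?m]) = {1..?m}" using d by (simp add: dperm_def)
  then have "set (wrap p) = {1..length (wrap p)}"
    unfolding w list.set(2) set by auto
  moreover have "distinct (wrap p)"
    using d unfolding w distinct.simps(2) set by (simp add: dperm_def)
  moreover have "dumont (wrap p)"
    using d e hd unfolding w dperm_def dumont_iff_successively successively_Cons
    by (simp add: dumont_step_def del: hd_append)
  ultimately show ?thesis using e by (simp add: even_dperm_def dperm_def w)
qed

text \<open>At the cut the odd \<open>n - 1\<close> steps up to the even \<open>n\<close>, which
  steps down into \<open>q\<close>; with \<open>q\<close> empty the even maximum would be
  last.\<close>

lemma even_dperm_join: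
  assumes "even_dperm p" "even_dperm q" "q \<noteq> []"
  shows "even_dperm (join p q)"
proof -
  let ?r = "length q"
  let ?n = "length p + ?r + 2"
  let ?p = "map (\<lambda>x. x + ?r) p @ [?n - 1]"
  have p: "even (length p)" "distinct p" "set p = {1..length p}" "dumont p" "av132 p"
    and q: "even ?r" "distinct q" "set q = {1..?r}" "dumont q" "av132 q"
    using assms by (auto simp: even_dperm_def dperm_def)
  have j: "join p q = ?p @ ?n # q" by (simp add: join_def)
  have setp: "set (map (\<lambda>x. x + ?r) p) = {?r + 1..?r + length p}"
    using image_add_atLeastAtMost'[of ?r 1 "length p"] by (simp add: p(3) add.commute)
  then have bigger: "\<forall>x\<in>set (map (\<lambda>x. x + ?r) p). x < ?n - 1" by auto
  have set_p: "set ?p = {?r + 1..?n - 1}" using setp by auto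
  have d: "dumont ?p" using dumont_snoc_bigger[OF bigger] dumont_shift[OF q(1)] p q by simp
  have a: "av132 ?p" using av132_snoc_bigger[OF bigger] av132_shift p by simp
  \<comment> \<open>An entry of \<open>q\<close> lies below every entry of \<open>?p\<close>, so it
    cannot be the 2 of a 132 whose 1 lies in \<open>?p\<close>.\<close>
  have a1: "sorted_wrt (\<lambda>b c. \<not> (x < c \<and> c < b)) (?n # q)" if "x \<in> set ?p" for x
  proof -
    have "\<forall>c\<in>set q. c < x" using that q(3) unfolding set_p by auto
    then show ?thesis by (auto intro!: sorted_wrt_if_all)
  qed
  have a1': "sorted_wrt (\<lambda>b c. \<not> (?n < c \<and> c < b)) q"
    by (rule sorted_wrt_if_all) (use q(3) in auto)
  \<comment> \<open>As a 2, \<open>?n\<close> is too large and an entry of \<open>q\<close> too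
    small.\<close>
  have a2: "sorted_wrt (\<lambda>a b. \<not> (a < c \<and> c < b)) ?p" if "c \<in> set (?n # q)" for c
  proof -
    have "\<not> (a < c \<and> c < b)" if "a \<in> set ?p" "b \<in> set ?p" for a b
      using that \<open>c \<in> set (?n # q)\<close> q(3) unfolding set_p by auto
    then show ?thesis by (rule sorted_wrt_if_all)
  qed
  have "av132 (join p q)"
    unfolding j by (subst av132_append, intro conjI ballI a a1 a2) (use a1' q(5) in auto)
  moreover have "hd q < ?n" "last q \<in> set q"
    using q(3) assms(3) hd_in_set[of q] by auto
  then have "dumont (join p q)"
    unfolding j using d q assms(3)
    by (auto simp: dumont_iff_successively successively_append_iff successively_Cons dumont_step_def p(1))
  moreover have "distinct (join p q)"
    unfolding j using p(2) q(2,3) set_p setp by (auto simp: distinct_map)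
  moreover have "set (join p q) = {1..length (join p q)}"
  proof -
    have "set (join p q) = {?r + 1..?n - 1} \<union> insert ?n {1..?r}"
      unfolding j set_append[of ?p] set_p by (simp only: list.set(2) q(3))
    also have "\<dots> = {1..?n}" by auto
    finally show ?thesis by (simp add: j)
  qed
  ultimately show ?thesis using p(1) q(1) by (simp add: even_dperm_def dperm_def j)
qed

text \<open>Every value up to the maximum of \<open>B\<close> lies in \<open>B\<close>, since a
  value in \<open>A\<close> would exceed that maximum.\<close>

lemma below_eq_atLeastAtMost:
  fixes A B :: "nat set"
  assumes "A \<union> B = {1..n}" "\<And>a b. a \<in> A \<Longrightarrow> b \<in> B \<Longrightarrow> b < a"
  shows "B = {1..card B}" "A = {card B + 1..n}"
proof -
  \<comment> \<open>Inserting 0 gives the maximum a value for empty \<open>B\<close>, where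
    \<open>{1..r}\<close> is then empty too.\<close>
  define r where "r = Max (insert 0 B)"
  have fin: "finite B" using assms(1) by (metis finite_Un finite_atLeastAtMost)
  have "B = {1..r}"
  proof (cases "B = {}")
    case False
    then have r: "r \<in> B" "\<forall>b\<in>B. b \<le> r" using fin Max_in[of B] by (auto simp: r_def)
    have "x \<in> B" if "1 \<le> x" "x \<le> r" for x
    proof -
      have "r \<in> {1..n}" using r(1) assms(1) by blast
      then have "x \<in> A \<union> B" using that assms(1) by simp
      then show ?thesis using assms(2)[OF _ r(1)] that by force
    qed
    moreover have "1 \<le> b" if "b \<in> B" for b using that assms(1) by auto
    ultimately show ?thesis using r(2) by (intro set_eqI) (metis atLeastAtMost_iff)
  qed (simp add: r_def)
  then show B: "B = {1..card B}" by simp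
  have "A \<inter> B = {}" using assms(2) by blast
  then have "A = {1..n} - {1..card B}" using assms(1) B by blast
  then show "A = {card B + 1..n}" by auto
qed

text \<open>The cut is at the maximum \<open>n\<close>; the parity of the length of the part
  \<open>R\<close> to its right decides between the two shapes.\<close>

lemma even_dperm_cases:
  assumes "even_dperm p" "p \<noteq> []"
  obtains (wrap) q where "even_dperm q" "p = wrap q"
  | (join) q r where "even_dperm q" "even_dperm r" "r \<noteq> []" "p = join q r"
proof -
  define n where "n = length p"
  have p: "even n" "n > 0" "distinct p" "set p = {1..n}" "successively dumont_step p"
    "odd (last p)" "av132 p"
    using assms by (auto simp: even_dperm_def dperm_def n_def dumont_iff_successively)
  have n2: "n \<ge> 2" "odd (n - 1)" using p(1,2) by presburger+
  have "n \<in> set p" using p by simp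
  then obtain L R where LR: "p = L @ n # R" by (meson split_list)
  have R: "R \<noteq> []" using p(1,6) by (auto simp: LR)
  have dist: "distinct L" "distinct R" "set L \<inter> set R = {}" "n \<notin> set L" "n \<notin> set R"
    using p(3) by (auto simp: LR)
  have un: "set L \<union> set R = {1..n - 1}"
  proof -
    have "insert n (set L \<union> set R) = set p" by (simp add: LR)
    also have "\<dots> = insert n {1..n - 1}" unfolding p(4) using p(2) by auto
    finally show ?thesis using dist p(2) by (subst (asm) insert_ident) auto
  qed
  \<comment> \<open>Otherwise \<open>a\<close>, \<open>n\<close>, \<open>b\<close> would form a
    132.\<close>
  have below: "b < a" if "a \<in> set L" "b \<in> set R" for a b
  proof -
    have "\<not> (a < b \<and> b < n)" using p(7) that by (auto simp: LR av132_append)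
    moreover have "b \<le> n - 1" using un that by auto
    moreover have "a \<noteq> b" using dist that by auto
    ultimately show ?thesis using p(2) by auto
  qed
  define r where "r = length R"
  have card: "card (set R) = r" using dist by (simp add: r_def distinct_card)
  have sets: "set R = {1..r}" "set L = {r + 1..n - 1}"
    using below_eq_atLeastAtMost[OF un] below unfolding card by blast+
  have len: "length L + r + 1 = n" using arg_cong[OF LR, of length] by (simp add: n_def r_def)
  have dR: "dperm R"
  proof -
    have "successively dumont_step R" "odd (last R)" "av132 R"
      using p(5-7) R by (simp_all add: LR av132_append successively_append_iff successively_Cons)
    then show ?thesis
      using dist(2) sets(1) unfolding dperm_def dumont_iff_successively r_def by blast
  qed
  show thesis
  proof (cases "even r")
    case True
    \<comment> \<open>By parity \<open>L\<close> is nonempty and contains \<open>n - 1\<close>;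
      being its odd maximum, \<open>n - 1\<close> is the last entry of \<open>L\<close>.\<close>
    have "r < n - 1"
      using len True p(1) by presburger
    then have mem: "n - 1 \<in> set L" using sets by auto
    have step: "successively dumont_step L" using p(5) by (simp add: LR successively_append_iff)
    have bound: "\<forall>x\<in>set L. x \<le> n - 1" unfolding sets by simp
    obtain L' where L': "L = L' @ [n - 1]"
      by (rule dumont_Max_last[OF step mem n2(2) bound])
    define q where "q = map (\<lambda>x. x - r) L'"
    have L'_set: "set L' = {r + 1..n - 2}"
    proof -
      have "set L' = set L - {n - 1}" using dist(1) by (simp add: L')
      also have "\<dots> = {r + 1..n - 2}" unfolding sets(2) by auto
      finally show ?thesis .
    qed
    then have shift: "L' = map (\<lambda>x. x + r) q"
      unfolding q_def map_map by (intro map_idI[symmetric]) simp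
    have lq: "length q + r + 2 = n" using len by (simp add: L' q_def)
    have "dumont (L' @ [n - 1])"
      using p(5) n2 by (simp add: LR L' dumont_iff_successively successively_append_iff)
    then have "dumont L'" using L'_set n2 by (subst (asm) dumont_snoc_bigger) auto
    then have "dumont q" using True by (simp add: shift dumont_shift)
    moreover have "av132 q" using p(7) by (simp add: LR L' av132_append shift av132_shift)
    moreover have "distinct q" using dist(1) by (simp add: L' shift distinct_map)
    moreover have "set q = {1..length q}"
    proof -
      have "(\<lambda>x. x + r) ` set q = (\<lambda>x. x + r) ` {1..length q}"
        using L'_set lq[symmetric]
        by (simp add: shift add.commute del: image_add_atLeastAtMost' image_add_atLeastAtMost)
           (simp add: image_add_atLeastAtMost')
      then show ?thesis by (subst (asm) inj_image_eq_iff) (simp_all add: inj_def)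
    qed
    moreover have "even (length q)" using lq True p(1) by presburger
    ultimately have "even_dperm q" by (simp add: even_dperm_def dperm_def)
    moreover have "p = join q R"
      using lq unfolding LR L' shift join_def by (auto simp: r_def)
    moreover have "even_dperm R" using dR True by (simp add: even_dperm_def r_def)
    ultimately show thesis using join R by blast
  next
    case False
    \<comment> \<open>The least entry of a nonempty \<open>L\<close> would be the even
      \<open>r + 1\<close>, whose successor must be at most \<open>r\<close>; but that successor is
      \<open>n\<close> or lies in \<open>L\<close>.\<close>
    have "L = []"
    proof (rule ccontr)
      assume "L \<noteq> []"
      then have "r + 1 \<in> set L" using len by (auto simp: sets Suc_leI)
      then obtain L1 L2 where L: "L = L1 @ (r + 1) # L2" by (meson split_list)
      have "dumont_step (r + 1) (hd (L2 @ n # R))"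
        using p(5) by (simp add: LR L successively_append_iff successively_Cons)
      then have "hd (L2 @ n # R) \<le> r" using False by (simp add: dumont_step_def)
      moreover have "hd (L2 @ n # R) \<in> insert n (set L)" by (cases L2) (auto simp: L)
      ultimately show False using sets len by auto
    qed
    have "odd (length R)" using False by (simp add: r_def)
    with dR obtain q where q: "even_dperm q" "R = snoc_max q" by (rule odd_dperm_cases)
    moreover have "p = wrap q"
      using \<open>L = []\<close> q(2) len by (auto simp: LR wrap_def snoc_max_def r_def)
    ultimately show thesis using wrap by blast
  qed
qed

text \<open>With \<open>n\<close> the total length, the first shape ends in \<open>n - 1\<close>,
  the second in an entry of \<open>r\<close>, which is at most
  \<open>length r < n - 1\<close>.\<close>

lemma wrap_neq_join:
  assumes "dperm r" "r \<noteq> []"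
  shows "wrap p \<noteq> join q r"
proof
  assume eq: "wrap p = join q r"
  have "length p = length q + length r"
    using arg_cong[OF eq, of length] by (simp add: wrap_def join_def)
  moreover have "length p + 1 = last r"
    using arg_cong[OF eq, of last] assms(2) by (simp add: wrap_def join_def)
  moreover have "last r \<le> length r" using dperm_bounds[OF assms(1) last_in_set[OF assms(2)]] by simp
  ultimately show False by simp
qed

lemma inj_wrap: "inj wrap"
  by (auto simp: inj_def wrap_def)

lemma inj_snoc_max: "inj snoc_max"
  by (auto simp: inj_def snoc_max_def)

text \<open>The total length fixes \<open>n\<close>, and \<open>n\<close> occurs only once, so both
  blocks can be read off.\<close>

lemma join_inject:
  assumes "dperm p" "dperm q" "dperm p'" "dperm q'" and eq: "join p q = join p' q'"
  shows "p = p' \<and> q = q'"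
proof -
  define n where "n = length p + length q + 2"
  have n': "n = length p' + length q' + 2"
    using arg_cong[OF eq, of length] by (simp add: n_def join_def)
  let ?P = "\<lambda>p q. map (\<lambda>x. x + length q) p @ [n - 1]"
  have "join p q = ?P p q @ n # q" "join p' q' = ?P p' q' @ n # q'"
    using n' by (simp_all add: n_def join_def)
  moreover have "n \<notin> set (?P p q)" "n \<notin> set q"
    using dperm_bounds[OF assms(1)] dperm_bounds[OF assms(2)] by (fastforce simp: n_def)+
  ultimately have "?P p q = ?P p' q' \<and> q = q'"
    using eq by (metis append_Cons_eq_iff)
  then show ?thesis by (auto simp: inj_map_eq_map inj_def)
qed

section \<open>Increasing subsequences under the decomposition\<close>

lemma incs_one: "\<forall>x\<in>set p. 0 < x \<Longrightarrow> incs 0 (Suc 0) p = length p"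
  by (induction p) auto

lemma incs_snoc_max:
  "dperm p \<Longrightarrow> incs 0 (Suc k) (snoc_max p) = incs 0 (Suc k) p + incs 0 k p"
  using dperm_bounds unfolding snoc_max_def by (intro incs_snoc) (fastforce simp: less_Suc_eq_le)+

lemma incs_wrap:
  assumes "dperm p"
  shows "incs 0 (Suc (Suc k)) (wrap p) = incs 0 (Suc (Suc k)) p + incs 0 (Suc k) p"
proof -
  let ?n = "length p + 2"
  have "wrap p = [?n] @ snoc_max p" by (simp add: wrap_def snoc_max_def)
  moreover have "\<forall>x\<in>set [?n]. \<forall>y\<in>set (snoc_max p). y < x"
    using dperm_bounds[OF assms] by (fastforce simp: snoc_max_def)
  ultimately show ?thesis
    by (simp only: incs_append incs_snoc_max[OF assms]) simp
qed

text \<open>The rule for appending a larger entry applies twice, to \<open>n - 1\<close> and to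
  \<open>n\<close>, which gives the coefficients 1, 2, 1; \<open>q\<close> lies below all of
  this.\<close>

lemma incs_join:
  assumes "dperm p" "dperm q"
  shows "incs 0 (Suc (Suc k)) (join p q) =
     incs 0 (Suc (Suc k)) p + 2 * incs 0 (Suc k) p + incs 0 k p + incs 0 (Suc (Suc k)) q"
proof -
  let ?r = "length q"
  let ?n = "length p + ?r + 2"
  let ?p = "map (\<lambda>x. x + ?r) p"
  have b: "\<forall>x\<in>set ?p. ?r < x \<and> x < ?n - 1" using dperm_bounds[OF assms(1)] by fastforce
  have j: "join p q = ((?p @ [?n - 1]) @ [?n]) @ q" by (simp add: join_def)
  \<comment> \<open>All entries of the shifted block exceed \<open>?r\<close>, so the bound 0 can be
    raised to \<open>?r\<close> and the shift cancels.\<close>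
  have "\<forall>x\<in>set ?p. 0 < x \<longleftrightarrow> 0 + ?r < x" using b by auto
  from incs_lower_bound_cong[OF this] have shift: "incs 0 i ?p = incs 0 i p" for i
    by (simp only: incs_shift)
  have 1: "incs 0 (Suc i) (?p @ [?n - 1]) = incs 0 (Suc i) ?p + incs 0 i ?p" for i
    by (rule incs_snoc) (use b in \<open>auto simp del: set_map\<close>)
  have 2: "incs 0 (Suc i) ((?p @ [?n - 1]) @ [?n])
      = incs 0 (Suc i) (?p @ [?n - 1]) + incs 0 i (?p @ [?n - 1])" for i
    by (rule incs_snoc) (use b in \<open>auto simp del: set_map\<close>)
  have "incs 0 (Suc (Suc k)) (join p q)
      = incs 0 (Suc (Suc k)) ((?p @ [?n - 1]) @ [?n]) + incs 0 (Suc (Suc k)) q"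
    unfolding j
  proof (rule incs_append, intro ballI)
    fix x y assume "x \<in> set ((?p @ [?n - 1]) @ [?n])" "y \<in> set q"
    then have "?r < x" "y \<le> ?r" using b dperm_bounds[OF assms(2)] by auto
    then show "y < x" by simp
  qed
  then show ?thesis unfolding 1 2 shift by simp
qed

section \<open>Even-length permutations with no or exactly one occurrence of 12...k\<close>

definition avoiders :: "nat \<Rightarrow> nat list set" where
  "avoiders k = {p. even_dperm p \<and> incs 0 k p = 0}"

text \<open>For \<open>k > 0\<close> the second condition is implied by the first. For \<open>k = 0\<close> it leaves only the
  empty permutation, which accounts for the value \<open>A\<^sub>0 = 1\<close> forced by the recurrence at \<open>k = 2\<close>.\<close>

definition singles :: "nat \<Rightarrow> nat list set" where
  "singles k = {p. even_dperm p \<and> incs 0 k p = 1 \<and> incs 0 (Suc k) p = 0}"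

lemma even_dperm_dperm: "even_dperm p \<Longrightarrow> dperm p"
  by (simp add: even_dperm_def)

lemma even_dperm_Nil: "even_dperm []"
  by (simp add: even_dperm_def dperm_Nil)

text \<open>Used with counts 0 and 1: vanishing passes to longer subsequences, so conditions on sums
  of counts reduce to few terms.\<close>

lemma incs_Suc_eq_0: "incs m k p \<le> k \<Longrightarrow> incs m (Suc k) p = 0"
  using incs_Suc_pos_imp_ge[of m k p] by linarith

lemma singles_Suc: "singles (Suc k) = {p. even_dperm p \<and> incs 0 (Suc k) p = 1}"
  unfolding singles_def by (intro Collect_cong) (auto intro: incs_Suc_eq_0)

lemma incs_one_even_dperm: "even_dperm p \<Longrightarrow> incs 0 (Suc 0) p = length p"
  by (rule incs_one) (auto simp: even_dperm_def dperm_def)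

text \<open>The empty subsequence always occurs, matching \<open>F 0 = 0\<close>.\<close>

lemma avoiders_0: "avoiders 0 = {}"
  by (simp add: avoiders_def)

lemma avoiders_1: "avoiders (Suc 0) = {[]}"
  by (auto simp: avoiders_def incs_one_even_dperm even_dperm_Nil)

lemma singles_0: "singles 0 = {[]}"
  by (auto simp: singles_def incs_one_even_dperm even_dperm_Nil)

text \<open>The count is the length, which is even and so never 1; this is the initial value
  \<open>A 1 = 0\<close>.\<close>

lemma singles_1: "singles (Suc 0) = {}"
  by (auto simp: singles_Suc incs_one_even_dperm) (simp add: even_dperm_def)

lemma wrap_in_avoiders_iff:
  assumes "even_dperm p"
  shows "wrap p \<in> avoiders (Suc (Suc k)) \<longleftrightarrow> p \<in> avoiders (Suc k)"
  using assms incs_Suc_eq_0[of 0 "Suc k" p]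
  by (auto simp: avoiders_def incs_wrap even_dperm_dperm even_dperm_wrap)

lemma join_in_avoiders_iff:
  assumes "even_dperm p" "even_dperm q" "q \<noteq> []"
  shows "join p q \<in> avoiders (Suc (Suc k)) \<longleftrightarrow> p \<in> avoiders k \<and> q \<in> avoiders (Suc (Suc k))"
  using assms incs_Suc_eq_0[of 0 k p] incs_Suc_eq_0[of 0 "Suc k" p]
  by (auto simp: avoiders_def incs_join even_dperm_dperm even_dperm_join)

lemma wrap_in_singles_iff:
  assumes "even_dperm p"
  shows "wrap p \<in> singles (Suc (Suc k)) \<longleftrightarrow> p \<in> singles (Suc k)"
proof -
  have "incs 0 (Suc (Suc k)) p + incs 0 (Suc k) p = 1 \<longleftrightarrow> incs 0 (Suc k) p = 1"
    using incs_Suc_eq_0[of 0 "Suc k" p] by linarith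
  then show ?thesis
    using assms by (simp add: singles_Suc incs_wrap even_dperm_dperm even_dperm_wrap)
qed

lemma join_in_singles_iff:
  assumes "even_dperm p" "even_dperm q" "q \<noteq> []"
  shows "join p q \<in> singles (Suc (Suc k)) \<longleftrightarrow>
     p \<in> avoiders k \<and> q \<in> singles (Suc (Suc k)) \<or> p \<in> singles k \<and> q \<in> avoiders (Suc (Suc k))"
proof -
  \<comment> \<open>Since vanishing at length \<open>k\<close> passes to longer lengths, a
    contribution of \<open>p\<close> forces \<open>incs 0 k p = 1\<close> and its other terms to be
    0. For \<open>k = 0\<close> this means \<open>p = []\<close>.\<close>
  have "incs 0 (Suc (Suc k)) p + 2 * incs 0 (Suc k) p + incs 0 k p + incs 0 (Suc (Suc k)) q = 1 \<longleftrightarrow>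
     incs 0 k p = 0 \<and> incs 0 (Suc (Suc k)) q = 1 \<or>
     incs 0 k p = 1 \<and> incs 0 (Suc k) p = 0 \<and> incs 0 (Suc (Suc k)) q = 0"
    using incs_Suc_eq_0[of 0 k p] incs_Suc_eq_0[of 0 "Suc k" p] by linarith
  then show ?thesis
    using assms unfolding singles_Suc singles_def[of k] avoiders_def
    by (simp add: incs_join even_dperm_dperm even_dperm_join)
qed

text \<open>The set reappears on the right as second factor; this self-reference produces the
  denominators. There \<open>[]\<close> is removed because \<open>join\<close> needs a nonempty
  second block.\<close>

lemma avoiders_rec:
  "avoiders (Suc (Suc k)) = ({[]} \<union> wrap ` avoiders (Suc k))
     \<union> (\<lambda>(p, q). join p q) ` (avoiders k \<times> (avoiders (Suc (Suc k)) - {[]}))" (is "?S = ?T")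
proof (intro equalityI subsetI)
  fix p assume p: "p \<in> ?S"
  then have ep: "even_dperm p" by (simp add: avoiders_def)
  show "p \<in> ?T"
  proof (cases "p = []")
    case False
    from ep False show ?thesis
    proof (cases rule: even_dperm_cases)
      case (wrap q)
      then show ?thesis using p wrap_in_avoiders_iff by blast
    next
      case (join q r)
      then have "(q, r) \<in> avoiders k \<times> (avoiders (Suc (Suc k)) - {[]})"
        using p join_in_avoiders_iff by blast
      then show ?thesis using join(4) by (auto intro: rev_image_eqI)
    qed
  qed simp
next
  fix p assume "p \<in> ?T"
  then consider "p = []" | q where "q \<in> avoiders (Suc k)" "p = wrap q"
    | q r where "q \<in> avoiders k" "r \<in> ?S" "r \<noteq> []" "p = join q r" by auto
  then show "p \<in> ?S"
  proof cases
    case 1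
    then show ?thesis by (simp add: avoiders_def even_dperm_Nil)
  next
    case (2 q)
    then have "even_dperm q" by (simp add: avoiders_def)
    then show ?thesis using 2 by (simp add: wrap_in_avoiders_iff)
  next
    case (3 q r)
    then have "even_dperm q" "even_dperm r" by (simp_all add: avoiders_def)
    then show ?thesis using 3 by (simp add: join_in_avoiders_iff)
  qed
qed

text \<open>The occurrence in a \<open>join\<close> either lies within the second block or is an
  increasing subsequence of the first extended by \<open>n - 1\<close> and \<open>n\<close>; this
  gives the two products.\<close>

lemma singles_rec:
  "singles (Suc (Suc k)) = (wrap ` singles (Suc k)
     \<union> (\<lambda>(p, q). join p q) ` (avoiders k \<times> singles (Suc (Suc k))))
     \<union> (\<lambda>(p, q). join p q) ` (singles k \<times> (avoiders (Suc (Suc k)) - {[]}))" (is "?S = ?T")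
proof (intro equalityI subsetI)
  fix p assume p: "p \<in> ?S"
  then have ep: "even_dperm p" "p \<noteq> []" by (auto simp: singles_def)
  then show "p \<in> ?T"
  proof (cases rule: even_dperm_cases)
    case (wrap q)
    then show ?thesis using p wrap_in_singles_iff by blast
  next
    case (join q r)
    then have "(q, r) \<in> avoiders k \<times> singles (Suc (Suc k)) \<or>
        (q, r) \<in> singles k \<times> (avoiders (Suc (Suc k)) - {[]})"
      using p join_in_singles_iff by blast
    then show ?thesis using join(4) by (auto intro: rev_image_eqI)
  qed
next
  fix p assume "p \<in> ?T"
  then consider q where "q \<in> singles (Suc k)" "p = wrap q"
    | q r where "q \<in> avoiders k \<and> r \<in> ?S \<or> q \<in> singles k \<and> r \<in> avoiders (Suc (Suc k)) \<and> r \<noteq> []"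
        "p = join q r" by auto
  then show "p \<in> ?S"
  proof cases
    case (1 q)
    then have "even_dperm q" by (simp add: singles_def)
    then show ?thesis using 1 by (simp add: wrap_in_singles_iff)
  next
    case (2 q r)
    then have "even_dperm q" "even_dperm r" "r \<noteq> []" by (auto simp: avoiders_def singles_def)
    then show ?thesis using 2 by (auto simp: join_in_singles_iff)
  qed
qed

section \<open>Generating functions\<close>

lemma finite_dperms_length: "S \<subseteq> Collect dperm \<Longrightarrow> finite {p \<in> S. length p = n}"
  by (rule finite_subset[OF _ finite_permutations_of_set[of "{1..n}"]])
     (auto simp: dperm_def permutations_of_set_def)

lemma inj_on_join: "inj_on (\<lambda>(p, q). join p q) (Collect dperm \<times> Collect dperm)"
proof (rule inj_onI, clarsimp)
  fix p q p' q'
  assume "dperm p" "dperm q" "dperm p'" "dperm q'" "join p q = join p' q'"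
  then show "p = p' \<and> q = q'" by (rule join_inject)
qed

lemma wrap_join_disjoint:
  assumes "\<And>q. q \<in> T \<Longrightarrow> dperm q \<and> q \<noteq> []"
  shows "wrap ` S \<inter> (\<lambda>(p, q). join p q) ` (R \<times> T) = {}"
proof -
  have "wrap p \<noteq> join q r" if "r \<in> T" for p q r
    using wrap_neq_join assms[OF that] by blast
  then show ?thesis by auto
qed

lemma wgf_join:
  assumes "S \<subseteq> Collect dperm" "T \<subseteq> Collect dperm"
  shows "wgf length ((\<lambda>(p, q). join p q) ` (S \<times> T)) = fps_X ^ 2 * (wgf length S * wgf length T)"
proof -
  have "inj_on (\<lambda>(p, q). join p q) (S \<times> T)"
    by (rule inj_on_subset[OF inj_on_join]) (use assms in blast)
  then have "wgf length ((\<lambda>(p, q). join p q) ` (S \<times> T))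
      = fps_X ^ 2 * wgf (\<lambda>(p, q). length p + length q) (S \<times> T)"
    by (rule wgf_image) (auto simp: join_def)
  also have "wgf (\<lambda>(p, q). length p + length q) (S \<times> T) = wgf length S * wgf length T"
    by (rule wgf_Times) (use assms finite_dperms_length in blast)+
  finally show ?thesis .
qed

lemma wgf_wrap: "wgf length (wrap ` S) = fps_X ^ 2 * wgf length S"
  by (rule wgf_image) (auto simp: wrap_def intro: inj_on_subset[OF inj_wrap])

lemma wgf_snoc_max: "wgf length (snoc_max ` S) = fps_X * wgf length S"
  using wgf_image[of snoc_max S length 1 length]
  by (auto simp: snoc_max_def intro: inj_on_subset[OF inj_snoc_max])

lemma wgf_empty: "wgf w {} = 0"
  by (rule fps_ext) (simp add: wgf_def)

lemma wgf_Nil: "wgf length {[]} = 1"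
proof (rule fps_ext)
  fix n
  have "{p \<in> {[]}. length p = n} = (if n = 0 then {[] :: 'a list} else {})" by auto
  then show "fps_nth (wgf length {[] :: 'a list}) n = fps_nth 1 n" by (simp add: wgf_def)
qed

lemma wgf_Un_dperms:
  assumes "S \<union> T \<subseteq> Collect dperm" "S \<inter> T = {}"
  shows "wgf length (S \<union> T) = wgf length S + wgf length T"
  using assms by (intro wgf_Un finite_dperms_length) auto

lemma avoiders_subset: "avoiders k \<subseteq> Collect dperm"
  by (auto simp: avoiders_def even_dperm_def)

lemma singles_subset: "singles k \<subseteq> Collect dperm"
  by (auto simp: singles_def even_dperm_def)

lemma wgf_avoiders_minus_Nil:
  "wgf length (avoiders (Suc k) - {[]}) = wgf length (avoiders (Suc k)) - 1"
proof -
  have "[] \<in> avoiders (Suc k)" by (simp add: avoiders_def even_dperm_Nil)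
  then have "wgf length (avoiders (Suc k)) = wgf length ({[]} \<union> (avoiders (Suc k) - {[]}))"
    by (simp add: insert_absorb)
  also have "\<dots> = 1 + wgf length (avoiders (Suc k) - {[]})"
    using avoiders_subset[of "Suc k"] dperm_Nil by (subst wgf_Un_dperms) (auto simp: wgf_Nil)
  finally show ?thesis by simp
qed

lemma wgf_avoiders_rec:
  fixes k
  defines "f \<equiv> \<lambda>k. wgf length (avoiders k)"
  shows "f (Suc (Suc k)) = 1 + fps_X ^ 2 * f (Suc k) + fps_X ^ 2 * (f k * (f (Suc (Suc k)) - 1))"
proof -
  let ?W = "wrap ` avoiders (Suc k)"
  let ?J = "(\<lambda>(p, q). join p q) ` (avoiders k \<times> (avoiders (Suc (Suc k)) - {[]}))"
  have sub: "({[]} \<union> ?W) \<union> ?J \<subseteq> Collect dperm"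
    using avoiders_subset[of "Suc (Suc k)"] by (simp only: avoiders_rec[symmetric])
  have "?W \<inter> ?J = {}" by (rule wrap_join_disjoint) (use avoiders_subset in blast)
  moreover have "[] \<notin> ?J" by (auto simp: join_def)
  ultimately have disj: "({[]} \<union> ?W) \<inter> ?J = {}" by blast
  have "f (Suc (Suc k)) = wgf length ({[]} \<union> ?W) + wgf length ?J"
    unfolding f_def using wgf_Un_dperms[OF sub disj] by (simp only: avoiders_rec[symmetric])
  also have "wgf length ({[]} \<union> ?W) = 1 + fps_X ^ 2 * f (Suc k)"
    using sub by (subst wgf_Un_dperms) (auto simp: wgf_Nil wgf_wrap f_def, simp add: wrap_def)
  also have "wgf length ?J = fps_X ^ 2 * (f k * (f (Suc (Suc k)) - 1))"
    using avoiders_subset by (subst wgf_join) (auto simp: f_def wgf_avoiders_minus_Nil)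
  finally show ?thesis .
qed

lemma wgf_singles_rec:
  fixes k
  defines "f \<equiv> \<lambda>k. wgf length (avoiders k)" and "g \<equiv> \<lambda>k. wgf length (singles k)"
  shows "g (Suc (Suc k)) = fps_X ^ 2 * g (Suc k) + fps_X ^ 2 * (f k * g (Suc (Suc k)))
     + fps_X ^ 2 * (g k * (f (Suc (Suc k)) - 1))"
proof -
  let ?W = "wrap ` singles (Suc k)"
  let ?J1 = "(\<lambda>(p, q). join p q) ` (avoiders k \<times> singles (Suc (Suc k)))"
  let ?J2 = "(\<lambda>(p, q). join p q) ` (singles k \<times> (avoiders (Suc (Suc k)) - {[]}))"
  have sub: "(?W \<union> ?J1) \<union> ?J2 \<subseteq> Collect dperm"
    using singles_subset[of "Suc (Suc k)"] by (simp only: singles_rec[symmetric])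
  have nonempty: "[] \<notin> singles (Suc (Suc k))" by (simp add: singles_def)
  have W1: "?W \<inter> ?J1 = {}" by (rule wrap_join_disjoint) (use singles_subset nonempty in blast)
  have W2: "?W \<inter> ?J2 = {}" by (rule wrap_join_disjoint) (use avoiders_subset in blast)
  \<comment> \<open>No list lies in both \<open>avoiders k\<close> and \<open>singles k\<close>, so
    the pairs differ in their first component, and \<open>join\<close> is injective.\<close>
  have J: "?J1 \<inter> ?J2 = {}"
  proof -
    let ?A = "avoiders k \<times> singles (Suc (Suc k))"
      and ?B = "singles k \<times> (avoiders (Suc (Suc k)) - {[]})"
    have "?A \<inter> ?B = {}" by (auto simp: avoiders_def singles_def)
    moreover have "?A \<subseteq> Collect dperm \<times> Collect dperm" "?B \<subseteq> Collect dperm \<times> Collect dperm"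
      using avoiders_subset singles_subset by blast+
    ultimately show ?thesis using inj_on_image_Int[OF inj_on_join] by (metis image_empty)
  qed
  have "g (Suc (Suc k)) = wgf length (?W \<union> ?J1) + wgf length ?J2"
    unfolding g_def using wgf_Un_dperms[OF sub] W2 J
    by (simp only: singles_rec[symmetric] Int_Un_distrib2 Un_empty simp_thms)
  also have "wgf length (?W \<union> ?J1) = wgf length ?W + wgf length ?J1"
    by (rule wgf_Un_dperms) (use sub W1 in auto)
  also have "wgf length ?W = fps_X ^ 2 * g (Suc k)" by (simp add: wgf_wrap g_def)
  also have "wgf length ?J1 = fps_X ^ 2 * (f k * g (Suc (Suc k)))"
    using wgf_join[OF avoiders_subset singles_subset] by (simp add: f_def g_def)
  also have "wgf length ?J2 = fps_X ^ 2 * (g k * (f (Suc (Suc k)) - 1))"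
    using avoiders_subset singles_subset
    by (subst wgf_join) (auto simp: f_def g_def wgf_avoiders_minus_Nil)
  finally show ?thesis .
qed

section \<open>Solving the linear equations for the generating functions\<close>

lemma fps_eq_divide_if:
  fixes u :: "rat fps"
  assumes "fps_nth u 0 \<noteq> 0" "f * u = g"
  shows "f = g / u"
proof -
  have "u \<noteq> 0" using assms(1) by auto
  then show ?thesis using assms(2) nonzero_mult_div_cancel_right[of u f] by simp
qed

lemma denominator_nth_0: "fps_nth (1 - fps_X ^ 2 * f :: rat fps) 0 = 1"
  by (simp add: fps_mult_nth)

text \<open>The equation is linear in the unknown: the term with factor \<open>F k\<close> moves to
  the left and gives the denominator. Thus \<open>F k\<close> counts even lengths only.\<close>

lemma wgf_avoiders: "wgf length (avoiders k) = F k"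
proof (induction k rule: F.induct)
  case (3 k)
  let ?f = "wgf length (avoiders (Suc (Suc k)))" and ?u = "1 - fps_X ^ 2 * F k"
  have "(?f - 1) * ?u = fps_X ^ 2 * F (Suc k)"
    using wgf_avoiders_rec[of k] 3 by (simp add: algebra_simps)
  then have "?f - 1 = fps_X ^ 2 * F (Suc k) / ?u"
    by (intro fps_eq_divide_if) (simp_all add: denominator_nth_0)
  then show ?case by (simp add: algebra_simps)
qed (simp_all add: avoiders_0 avoiders_1 wgf_empty wgf_Nil)

text \<open>The self-referential term gives one factor \<open>u\<close> in the denominator; the
  second comes from \<open>F (Suc (Suc k)) - 1\<close>, itself a quotient by
  \<open>u\<close>.\<close>

lemma wgf_singles:
  fixes k
  defines "g \<equiv> \<lambda>k. wgf length (singles k)" and "u \<equiv> 1 - fps_X ^ 2 * F k"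
  shows "g (Suc (Suc k)) = fps_X ^ 2 / u * g (Suc k) + fps_X ^ 4 * F (Suc k) / u ^ 2 * g k"
proof -
  have u0: "fps_nth u 0 \<noteq> 0" by (simp add: u_def denominator_nth_0)
  then have inv: "inverse u * u = 1" by (rule inverse_mult_eq_1)
  have div: "h / u = h * inverse u" "h / u ^ 2 = h * inverse u ^ 2" for h
    using u0 by (simp_all add: fps_divide_unit fps_inverse_power)
  have F: "F (Suc (Suc k)) - 1 = fps_X ^ 2 * F (Suc k) * inverse u"
    by (simp add: u_def[symmetric] div)
  have "g (Suc (Suc k)) * u
      = fps_X ^ 2 * g (Suc k) + fps_X ^ 2 * (g k * (F (Suc (Suc k)) - 1))"
    using wgf_singles_rec[of k] unfolding wgf_avoiders g_def u_def
    by (simp add: algebra_simps del: F.simps)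
  then have "g (Suc (Suc k)) * u * inverse u
      = (fps_X ^ 2 * g (Suc k) + fps_X ^ 2 * (g k * (fps_X ^ 2 * F (Suc k) * inverse u))) * inverse u"
    unfolding F by simp
  then have "g (Suc (Suc k)) * (inverse u * u)
      = fps_X ^ 2 * inverse u * g (Suc k) + fps_X ^ 4 * F (Suc k) * inverse u ^ 2 * g k"
    by (simp add: algebra_simps power2_eq_square power4_eq_xxxx)
  then show ?thesis unfolding div inv by simp
qed

text \<open>Odd lengths enter here. Appending the maximum adds the counts for lengths
  \<open>k + 2\<close> and \<open>k + 1\<close>, and a sum of 1 forces the latter to be 1.\<close>

lemma dperm_single_occurrence:
  "{p. dperm p \<and> incs 0 (Suc (Suc k)) p = 1} = singles (Suc (Suc k)) \<union> snoc_max ` singles (Suc k)"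
  (is "?S = ?T")
proof -
  have snoc: "incs 0 (Suc (Suc k)) (snoc_max q) = 1 \<longleftrightarrow> q \<in> singles (Suc k)" if "even_dperm q" for q
  proof -
    have "incs 0 (Suc (Suc k)) (snoc_max q) = incs 0 (Suc (Suc k)) q + incs 0 (Suc k) q"
      using that by (intro incs_snoc_max even_dperm_dperm)
    then show ?thesis using that incs_Suc_eq_0[of 0 "Suc k" q] by (auto simp: singles_Suc)
  qed
  show ?thesis
  proof (intro equalityI subsetI)
    fix p assume p: "p \<in> ?S"
    show "p \<in> ?T"
    proof (cases "even (length p)")
      case True
      then show ?thesis using p by (simp add: singles_Suc even_dperm_def)
    next
      case False
      with p obtain q where "even_dperm q" "p = snoc_max q" using odd_dperm_cases by blast
      then show ?thesis using p snoc by blast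
    qed
  next
    fix p assume "p \<in> ?T"
    then consider "p \<in> singles (Suc (Suc k))" | q where "q \<in> singles (Suc k)" "p = snoc_max q" by blast
    then show "p \<in> ?S"
    proof cases
      case 1
      then show ?thesis by (simp add: singles_Suc even_dperm_def)
    next
      case 2
      then have q: "even_dperm q" by (simp add: singles_def)
      then have "dperm p" using 2 by (simp add: even_dperm_def dperm_snoc_max_iff)
      then show ?thesis using snoc[OF q] 2 by simp
    qed
  qed
qed

lemma D_gf_upt:
  "D_gf [1..<Suc (Suc (Suc k))] 1
     = wgf length (singles (Suc (Suc k))) + fps_X * wgf length (singles (Suc k))"
proof -
  let ?k = "Suc (Suc k)"
  have "D_gf [1..<Suc ?k] 1 = wgf length {p. dperm p \<and> incs 0 ?k p = 1}"
  proof (rule fps_ext)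
    fix n
    have "{p \<in> permutations_of_set {1..n}. dumont p \<and> occurrences [1, 3, 2] p = 0 \<and>
        occurrences [1..<Suc ?k] p = 1} = {p \<in> {p. dperm p \<and> incs 0 ?k p = 1}. length p = n}"
    proof (rule set_eqI)
      fix p :: "nat list"
      have "p \<in> permutations_of_set {1..n} \<longleftrightarrow> distinct p \<and> set p = {1..length p} \<and> length p = n"
      proof
        assume "p \<in> permutations_of_set {1..n}"
        then have "set p = {1..n}" "distinct p" by (auto dest: permutations_of_setD)
        moreover from this have "length p = n" using distinct_card[of p] by simp
        ultimately show "distinct p \<and> set p = {1..length p} \<and> length p = n" by simp
      qed (auto intro!: permutations_of_setI)
      moreover have "occurrences [1..<Suc ?k] p = incs 0 ?k p" if "set p = {1..length p}"
        by (rule occurrences_upt) (use that in auto)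
      ultimately show "p \<in> {p \<in> permutations_of_set {1..n}. dumont p \<and>
          occurrences [1, 3, 2] p = 0 \<and> occurrences [1..<Suc ?k] p = 1} \<longleftrightarrow>
          p \<in> {p \<in> {p. dperm p \<and> incs 0 ?k p = 1}. length p = n}"
        unfolding mem_Collect_eq dperm_def occurrences_132_eq_0_iff by metis
    qed
    then show "fps_nth (D_gf [1..<Suc ?k] 1) n
        = fps_nth (wgf length {p. dperm p \<and> incs 0 ?k p = 1}) n"
      by (simp only: D_gf_def D_count_def wgf_def fps_nth_Abs_fps)
  qed
  also have "\<dots> = wgf length (singles ?k) + wgf length (snoc_max ` singles (Suc k))"
    unfolding dperm_single_occurrence
  proof (rule wgf_Un_dperms)
    show "singles ?k \<union> snoc_max ` singles (Suc k) \<subseteq> Collect dperm"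
      unfolding dperm_single_occurrence[symmetric] by blast
    show "singles ?k \<inter> snoc_max ` singles (Suc k) = {}"
      by (auto simp: singles_def even_dperm_def snoc_max_def)
  qed
  finally show ?thesis by (simp add: wgf_snoc_max)
qed

theorem theorem3p1:
  fixes A :: "nat \<Rightarrow> rat fps"
  assumes "A 1 = 0"
    and "A 2 = fps_X ^ 4"
    and "\<And>k. k \<ge> 2 \<Longrightarrow>
      A k = fps_X ^ 2 / (1 - fps_X ^ 2 * F (k - 2)) * A (k - 1)
          + fps_X ^ 4 * F (k - 1) / (1 - fps_X ^ 2 * F (k - 2)) ^ 2 * A (k - 2)"
  shows "\<forall>k\<ge>2. D_gf [1..<Suc k] 1 = A k + fps_X * A (k - 1)"
proof -
  \<comment> \<open>At \<open>k = 2\<close>, with \<open>F 0 = 0\<close>, \<open>F 1 = 1\<close> and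
    \<open>A 1 = 0\<close>, the recurrence reads \<open>x^4 = x^4 * A 0\<close>, which determines
    \<open>A 0\<close>.\<close>
  have "fps_X ^ 4 * A 0 = fps_X ^ 4 * 1"
    using assms(3)[of 2] assms(1,2) by simp
  then have A0: "A 0 = 1" by (subst (asm) mult_cancel_left) simp
  \<comment> \<open>Two consecutive indices are carried along because the recurrence has order
    two.\<close>
  have A: "wgf length (singles k) = A k \<and> wgf length (singles (Suc k)) = A (Suc k)" for k
  proof (induction k)
    case 0
    then show ?case using A0 assms(1) by (simp add: singles_0 singles_1 wgf_Nil wgf_empty)
  next
    case (Suc k)
    then show ?case using wgf_singles[of k] assms(3)[of "Suc (Suc k)"] by simp
  qed
  show ?thesis
  proof (intro allI impI)
    fix k :: nat
    assume "2 \<le> k"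
    then obtain j where "k = Suc (Suc j)" by (metis add_2_eq_Suc le_Suc_ex)
    then show "D_gf [1..<Suc k] 1 = A k + fps_X * A (k - 1)"
      using D_gf_upt[of j] A[of "Suc j"] by (simp del: upt_Suc)
  qed
qed

end
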